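(* Let $d:[0,1]\to[0,\infty)$ be a continuous function satisfying $d(0)=0$ and $d(x)>0$ for $x>0$. Define a variance profile by $\sigma_{ij}^2=d(i/n)d(j/n)$ for $i,j\in\{1,\dots,n\}$ and let $\rho_\infty=\int_0^1d^2(x)\,dx$. Let $f_\infty(z)$ be the associated density (defined in the context) for $|z|\in(0,\sqrt{\rho_\infty})$. Then $$f_\infty(z)\ \sim\ \frac1\pi\int_0^1\frac{d^2(x)}{[|z|^2+d^2(x)\,u_\infty(|z|)]^2}\,dx\quad\text{as }z\to0,$$ i.e. the ratio of the two sides tends to $1$ as $z\to0$, $z\ne0$.
   Context: For $s\in(0,\sqrt{\rho_\infty})$, $u_\infty(s)$ denotes the unique positive solution of $\int_0^1\frac{d^2(x)}{s^2+d^2(x)u_\infty(s)}\,dx=1$; set $u_\infty(s)=0$ for $s\ge\sqrt{\rho_\infty}$. The limit as $s\downarrow0$ of $u_\infty(s)$ exists and defines $u_\infty(0)$. The function $F_\infty(s)=1-u_\infty(s)$, $s\ge0$, defines a rotationally invariant probability measure $\mu_\infty$ on $\mathbb{C}$ via $\mu_\infty(\{|z|\le s\})=F_\infty(s)$, which is the limit of the empirical spectral distributions of the random matrices with variance profile $(\sigma_{ij}^2)$. The function $u_\infty$ is continuously differentiable on $(0,\sqrt{\rho_\infty})$, and $f_\infty$ is the density of $\mu_\infty$, i.e. $f_\infty(z)=-\frac1{2\pi|z|}u_\infty'(|z|)$ for $|z|\in(0,\sqrt{\rho_\infty})$. *)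

theory Defs
  imports "HOL-Analysis.Analysis"
begin

definition rho_inf :: "(real \<Rightarrow> real) \<Rightarrow> real" where
  "rho_inf d = integral {0..1} (\<lambda>x. (d x)\<^sup>2)"

(* The values of u_infinity on (0, \<infinity>); arguments s \<le> 0 carry the dummy value 0. *)
definition u_inf_pos :: "(real \<Rightarrow> real) \<Rightarrow> real \<Rightarrow> real" where
  "u_inf_pos d s =
     (if 0 < s \<and> s < sqrt (rho_inf d)
      then (THE u. u > 0 \<and> integral {0..1} (\<lambda>x. (d x)\<^sup>2 / (s\<^sup>2 + (d x)\<^sup>2 * u)) = 1)
      else 0)"

definition u_inf :: "(real \<Rightarrow> real) \<Rightarrow> real \<Rightarrow> real" where
  "u_inf d s = (if s = 0 then Lim (at_right 0) (u_inf_pos d) else u_inf_pos d s)"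

(* Density, with respect to Lebesgue measure on the plane, of the rotationally invariant
   probability measure that gives mass 1 - u_inf d s to the closed disc of radius s.
   The formula is meaningful for 0 < |z| < sqrt (rho_inf d). *)
definition f_inf :: "(real \<Rightarrow> real) \<Rightarrow> complex \<Rightarrow> real" where
  "f_inf d z = - (1 / (2 * pi * norm z)) * deriv (u_inf d) (norm z)"

end

theory Submission
  imports Defs
begin

text \<open>
  Write \<open>g = d\<^sup>2\<close>, \<open>t = s\<^sup>2\<close> and \<open>u = u\<^sub>\<infinity>(s)\<close>, so that \<open>u\<close> is determined by
  \<open>\<integral> g / (t + g u) = 1\<close>.  Put \<open>D = \<integral> g / (t + g u)\<^sup>2\<close> and \<open>E = \<integral> g\<^sup>2 / (t + g u)\<^sup>2\<close>.
  Implicit differentiation of the equation gives \<open>u\<^sub>\<infinity>'(s) = - 2 s D / E\<close>, that is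
  \<open>f\<^sub>\<infinity>(z) = D / (\<pi> E)\<close> at \<open>|z| = s\<close>.  For \<open>0 < |z| < sqrt \<rho>\<^sub>\<infinity>\<close> the ratio in the theorem is
  therefore exactly \<open>1 / E\<close>, and what has to be shown is \<open>E \<longlongrightarrow> 1\<close> as \<open>s\<close> tends to \<open>0\<close>.

  The number \<open>y = g u / (t + g u)\<close> lies in \<open>[0, 1]\<close> and has integral \<open>u\<close>, while \<open>y\<^sup>2\<close> has integral
  \<open>u\<^sup>2 E\<close>.  Integrating \<open>2 y - 1 \<le> y\<^sup>2 \<le> y\<close> gives \<open>2 u - 1 \<le> u\<^sup>2 E \<le> u\<close>
  (lemma \<open>square_mass_bounds\<close>), so it suffices that \<open>u \<longlongrightarrow> 1\<close>.
  The integral of \<open>y\<close> shows \<open>u \<le> 1\<close>.  The lower bound holds because \<open>g\<close> is positive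
  away from \<open>0\<close>: for \<open>0 < a < 1\<close> the integral \<open>\<integral> g / (t + g a)\<close> tends to \<open>1 / a > 1\<close> as \<open>t\<close> tends
  to \<open>0\<close>, and the integral decreases in \<open>a\<close>, which forces \<open>a < u\<close> (lemma \<open>solution_tendsto_1\<close>).

  One algebraic identity, \<open>resolvent_identity\<close>, replaces both differentiation under the integral
  sign and the implicit function theorem: it yields strict monotonicity of the integral in \<open>u\<close>,
  hence uniqueness and continuity of the solution, and it yields the difference quotient of
  \<open>u\<^sub>\<infinity>\<close> in closed form.
\<close>

section \<open>Weighted integrals of the resolvent\<close>

text \<open>The weight \<open>w\<close> is left free so that \<open>D\<close> and \<open>E\<close>, and the mixed integrals at two different
  pairs \<open>(p, q)\<close> that occur in difference quotients, are all instances: one factor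
  \<open>1 / (p + g q)\<close> goes into the weight.\<close>

definition resolvent_integral ::
    "(real \<Rightarrow> real) \<Rightarrow> (real \<Rightarrow> real) \<Rightarrow> real \<Rightarrow> real \<Rightarrow> real" where
  "resolvent_integral g w p q = integral {0..1} (\<lambda>x. w x / (p + g x * q))"

locale profile =
  fixes g :: "real \<Rightarrow> real"
  assumes cont: "continuous_on {0..1} g"
    and nonneg: "\<And>x. x \<in> {0..1} \<Longrightarrow> 0 \<le> g x"
    and pos: "\<And>x. 0 < x \<Longrightarrow> x \<le> 1 \<Longrightarrow> 0 < g x"
begin

abbreviation "I \<equiv> resolvent_integral g"

lemma denominator_pos:
  assumes "0 < p" "0 \<le> q" "x \<in> {0..1}"
  shows "0 < p + g x * q"
  using assms nonneg[of x] by (simp add: add_pos_nonneg)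

lemma integrand_continuous:
  assumes "continuous_on {0..1} w" "0 < p" "0 \<le> q"
  shows "continuous_on {0..1} (\<lambda>x. w x / (p + g x * q))"
  using denominator_pos[OF assms(2,3)]
  by (intro continuous_intros assms cont) (metis less_irrefl)

lemma integrand_integrable:
  assumes "continuous_on {0..1} w" "0 < p" "0 \<le> q"
  shows "(\<lambda>x. w x / (p + g x * q)) integrable_on {0..1}"
  by (intro integrable_continuous_real integrand_continuous assms)

lemma resolvent_integral_pos:
  assumes w: "continuous_on {0..1} w" "\<And>x. x \<in> {0..1} \<Longrightarrow> 0 \<le> w x" "0 < w 1"
    and pq: "0 < p" "0 \<le> q"
  shows "0 < I w p q"
proof -
  let ?f = "\<lambda>x. w x / (p + g x * q)"
  have nn: "0 \<le> ?f x" if "x \<in> {0..1}" for x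
    using w(2)[OF that] denominator_pos[OF pq that] by simp
  have "integral (cbox 0 1) ?f \<noteq> 0"
  proof
    assume "integral (cbox 0 1) ?f = 0"
    then have "?f 1 = 0"
      using integral_eq_0_iff[of 0 1 ?f] integrand_continuous[OF w(1) pq] nn by auto
    then show False using w(3) denominator_pos[OF pq, of 1] by simp
  qed
  moreover have "0 \<le> integral {0..1} ?f"
    by (intro Henstock_Kurzweil_Integration.integral_nonneg integrand_integrable w pq nn)
  ultimately show ?thesis by (simp add: resolvent_integral_def)
qed

lemma resolvent_integral_continuous:
  assumes w: "continuous_on {0..1} w"
  shows "continuous_on ({0<..} \<times> {0..}) (\<lambda>(p, q). I w p q)"
proof -
  let ?U = "{0<..} \<times> {0..} :: (real \<times> real) set"
  have c: "continuous_on (?U \<times> {0..1}) (\<lambda>y. h (snd y))"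
    if "continuous_on {0..1} h" for h :: "real \<Rightarrow> real"
    by (rule continuous_on_compose2[OF that]) (auto intro!: continuous_intros)
  have "continuous_on (?U \<times> {0..1})
      (\<lambda>y. w (snd y) / (fst (fst y) + g (snd y) * snd (fst y)))"
  proof (intro continuous_intros c w cont ballI)
    fix y :: "(real \<times> real) \<times> real" assume "y \<in> ?U \<times> {0..1}"
    then show "fst (fst y) + g (snd y) * snd (fst y) \<noteq> 0"
      using denominator_pos[of "fst (fst y)" "snd (fst y)" "snd y"] by auto
  qed
  then have "continuous_on ?U
      (\<lambda>x. integral (cbox 0 1) (\<lambda>t. w t / (fst x + g t * snd x)))"
    by (intro integral_continuous_on_param) (simp add: case_prod_unfold)
  then show ?thesis by (simp add: resolvent_integral_def case_prod_unfold)
qed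

lemma resolvent_integral_tendsto:
  assumes w: "continuous_on {0..1} w" and lim: "(a \<longlongrightarrow> p) F" "(b \<longlongrightarrow> q) F"
    and pq: "0 < p" "0 \<le> q"
    and ev: "eventually (\<lambda>y. 0 < a y) F" "eventually (\<lambda>y. 0 \<le> b y) F"
  shows "((\<lambda>y. I w (a y) (b y)) \<longlongrightarrow> I w p q) F"
proof -
  have "((\<lambda>y. (a y, b y)) \<longlongrightarrow> (p, q)) F" by (intro tendsto_Pair lim)
  moreover have "eventually (\<lambda>y. (a y, b y) \<in> {0<..} \<times> {0..}) F"
    using ev by eventually_elim simp
  ultimately show ?thesis
    using continuous_on_tendsto_compose[OF resolvent_integral_continuous[OF w],
        of "\<lambda>y. (a y, b y)" "(p, q)" F] pq by simp
qed

lemma weight_continuous: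
  assumes "0 < p" "0 \<le> q"
  shows "continuous_on {0..1} (\<lambda>x. g x ^ k / (p + g x * q))"
  by (intro integrand_continuous continuous_intros cont assms)

lemma weight_pos:
  assumes "0 < p" "0 \<le> q" "0 < p'" "0 \<le> q'"
  shows "0 < I (\<lambda>x. g x ^ k / (p + g x * q)) p' q'"
  using assms
  by (intro resolvent_integral_pos weight_continuous)
     (auto intro!: divide_nonneg_pos divide_pos_pos zero_le_power zero_less_power
       denominator_pos nonneg pos)

text \<open>This is \<open>1/A - 1/B = (B - A) / (A B)\<close> with \<open>A = p + g q\<close> and \<open>B = p' + g q'\<close>, multiplied by
  \<open>g\<close> and integrated; the increments of \<open>p\<close> and \<open>q\<close> come out as separate factors.
  The weights are written \<open>g x ^ k / (p + g x * q)\<close>, also for \<open>k = 1\<close>, to be treated uniformly.\<close>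

lemma resolvent_identity:
  assumes pq: "0 < p" "0 \<le> q" "0 < p'" "0 \<le> q'"
  shows "I g p q - I g p' q' =
    (p' - p) * I (\<lambda>x. g x ^ 1 / (p + g x * q)) p' q' +
    (q' - q) * I (\<lambda>x. g x ^ 2 / (p + g x * q)) p' q'"
proof -
  have *: "g x / (p + g x * q) - g x / (p' + g x * q') =
      (p' - p) * (g x ^ 1 / (p + g x * q) / (p' + g x * q')) +
      (q' - q) * (g x ^ 2 / (p + g x * q) / (p' + g x * q'))" if "x \<in> {0..1}" for x
    using denominator_pos[OF pq(1,2) that] denominator_pos[OF pq(3,4) that]
    by (simp add: divide_simps power2_eq_square) algebra
  have i: "(\<lambda>x. g x ^ k / (p + g x * q) / (p' + g x * q')) integrable_on {0..1}" for k
    by (intro integrand_integrable weight_continuous pq)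
  have "I g p q - I g p' q' =
      integral {0..1} (\<lambda>x. g x / (p + g x * q) - g x / (p' + g x * q'))"
    unfolding resolvent_integral_def
    by (intro integral_diff[symmetric] integrand_integrable cont pq)
  also have "\<dots> = integral {0..1} (\<lambda>x.
      (p' - p) * (g x ^ 1 / (p + g x * q) / (p' + g x * q')) +
      (q' - q) * (g x ^ 2 / (p + g x * q) / (p' + g x * q')))"
    by (intro integral_cong *)
  also have "\<dots> = (p' - p) * I (\<lambda>x. g x ^ 1 / (p + g x * q)) p' q' +
    (q' - q) * I (\<lambda>x. g x ^ 2 / (p + g x * q)) p' q'"
    unfolding resolvent_integral_def
    by (simp only: integral_add[OF integrable_on_mult_right[OF i] integrable_on_mult_right[OF i]]
        integral_mult_right)
  finally show ?thesis .
qed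

section \<open>The defining equation\<close>

lemma resolvent_integral_strict_antimono:
  assumes "0 < p" "0 \<le> q" "q < q'"
  shows "I g p q' < I g p q"
proof -
  have "0 < (q' - q) * I (\<lambda>x. g x ^ 2 / (p + g x * q)) p q'"
    using assms by (intro mult_pos_pos weight_pos) auto
  then show ?thesis using resolvent_identity[of p q p q'] assms by simp
qed

lemma resolvent_integral_less_iff:
  assumes "0 < p" "0 \<le> q" "0 \<le> q'"
  shows "I g p q < I g p q' \<longleftrightarrow> q' < q"
  using resolvent_integral_strict_antimono[of p q q'] resolvent_integral_strict_antimono[of p q' q]
    assms by (cases q q' rule: linorder_cases) auto

lemma resolvent_integral_at_1_le:
  assumes "0 < p"
  shows "I g p 1 \<le> 1"
proof -
  have "integral {0..1} (\<lambda>x. g x / (p + g x * 1)) \<le> integral {0..1} (\<lambda>x::real. 1::real)"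
    using assms denominator_pos[of p 1] nonneg
    by (intro integral_le integrand_integrable cont) (auto simp: divide_simps)
  then show ?thesis by (simp add: resolvent_integral_def)
qed

lemma solution_exists_unique:
  assumes t: "0 < t" "t < integral {0..1} g"
  shows "\<exists>!u. 0 < u \<and> I g t u = 1"
proof -
  have "I g t 0 = integral {0..1} (\<lambda>x. g x / t)" by (simp add: resolvent_integral_def)
  also have "\<dots> = integral {0..1} g / t" by simp
  finally have at0: "1 < I g t 0" using t by simp
  have "continuous_on {0..1} (\<lambda>q. I g t q)"
    using t by (intro continuous_on_compose2[OF resolvent_integral_continuous[OF cont], 
        of "{0..1}" "\<lambda>q. (t, q)", simplified] continuous_intros) auto
  then obtain u where u: "0 \<le> u" "I g t u = 1"
    using IVT2'[of "I g t" 1 1 0] at0 resolvent_integral_at_1_le[OF t(1)] by auto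
  then have "0 < u" using at0 by (cases "u = 0") auto
  with u show ?thesis
    using resolvent_integral_less_iff[OF t(1)] by (metis less_imp_le less_irrefl linorder_cases)
qed

text \<open>With \<open>y = g u / (t + g u)\<close> these are the integrated inequalities \<open>2 y - 1 \<le> y\<^sup>2 \<le> y\<close>.\<close>

lemma square_mass_bounds:
  assumes t: "0 < t" and u: "0 < u" and eq: "I g t u = 1"
  defines "E \<equiv> I (\<lambda>x. g x ^ 2 / (t + g x * u)) t u"
  shows "2 * u - 1 \<le> u\<^sup>2 * E" and "u\<^sup>2 * E \<le> u"
proof -
  have iE: "(\<lambda>x. u\<^sup>2 * (g x ^ 2 / (t + g x * u) / (t + g x * u))) integrable_on {0..1}"
    using t u by (intro integrable_on_mult_right integrand_integrable weight_continuous) auto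
  have i1: "(\<lambda>x. g x / (t + g x * u)) integrable_on {0..1}"
    using t u by (intro integrand_integrable cont) auto
  have E: "u\<^sup>2 * E = integral {0..1} (\<lambda>x. u\<^sup>2 * (g x ^ 2 / (t + g x * u) / (t + g x * u)))"
    by (simp only: E_def resolvent_integral_def integral_mult_right)
  have y: "u\<^sup>2 * (g x ^ 2 / (t + g x * u) / (t + g x * u)) = (u * (g x / (t + g x * u)))\<^sup>2" for x
    by (simp add: power2_eq_square)
  have "integral {0..1} (\<lambda>x. 2 * u * (g x / (t + g x * u)) - 1) \<le> u\<^sup>2 * E"
    unfolding E
  proof (intro integral_le iE integrable_diff integrable_on_mult_right i1 integrable_const_ivl)
    fix x
    have "0 \<le> (u * (g x / (t + g x * u)) - 1)\<^sup>2" by simp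
    then show "2 * u * (g x / (t + g x * u)) - 1 \<le> u\<^sup>2 * (g x ^ 2 / (t + g x * u) / (t + g x * u))"
      unfolding y by (simp add: power2_diff)
  qed
  moreover have "integral {0..1} (\<lambda>x. 2 * u * (g x / (t + g x * u)) - 1) = 2 * u * I g t u - 1"
    unfolding resolvent_integral_def
    by (simp only: integral_diff[OF integrable_on_mult_right[OF i1] integrable_const_ivl]
        integral_mult_right) simp
  ultimately show "2 * u - 1 \<le> u\<^sup>2 * E" using eq by simp
  have "u\<^sup>2 * E \<le> integral {0..1} (\<lambda>x. u * (g x / (t + g x * u)))"
    unfolding E
  proof (intro integral_le iE integrable_on_mult_right i1)
    fix x :: real assume x: "x \<in> {0..1}"
    have "0 \<le> u * (g x / (t + g x * u))" "u * (g x / (t + g x * u)) \<le> 1"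
      using denominator_pos[of t u x] nonneg[OF x] t u x by (auto simp: divide_simps mult.commute)
    then show "u\<^sup>2 * (g x ^ 2 / (t + g x * u) / (t + g x * u)) \<le> u * (g x / (t + g x * u))"
      unfolding y unfolding power2_eq_square by (metis mult_left_le)
  qed
  also have "\<dots> = u * I g t u" by (simp only: resolvent_integral_def integral_mult_right)
  finally show "u\<^sup>2 * E \<le> u" using eq by simp
qed

text \<open>Choose \<open>\<delta>\<close> with \<open>0 < \<delta> < 1 - a\<close>.  On the compact interval \<open>[\<delta>, 1]\<close> the function \<open>g\<close> is at least some
  \<open>m > 0\<close>, so the integral is at least \<open>(1 - \<delta>) m / (p + m a)\<close>, whose limit is \<open>(1 - \<delta>) / a > 1\<close>.\<close>

lemma eventually_resolvent_integral_gt_1: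
  assumes a: "0 < a" "a < 1"
  shows "eventually (\<lambda>p. 1 < I g p a) (at_right 0)"
proof -
  define \<delta> where "\<delta> = (1 - a) / 2"
  have \<delta>: "0 < \<delta>" "\<delta> < 1" "a < 1 - \<delta>" using a by (auto simp: \<delta>_def field_simps)
  have "continuous_on {\<delta>..1} g" using cont \<delta> by (auto intro: continuous_on_subset)
  then obtain x0 where x0: "x0 \<in> {\<delta>..1}" "\<And>x. x \<in> {\<delta>..1} \<Longrightarrow> g x0 \<le> g x"
    using continuous_attains_inf[of "{\<delta>..1}" g] \<delta> by auto
  define m where "m = g x0"
  have m: "0 < m" using pos[of x0] x0 \<delta> by (simp add: m_def)
  have "((\<lambda>p. (1 - \<delta>) * (m / (p + m * a))) \<longlongrightarrow> (1 - \<delta>) * (m / (0 + m * a))) (at_right 0)"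
    using m a by (intro tendsto_intros) auto
  moreover have "1 < (1 - \<delta>) * (m / (0 + m * a))" using m a \<delta> by simp
  ultimately have "eventually (\<lambda>p. 1 < (1 - \<delta>) * (m / (p + m * a))) (at_right 0)"
    by (rule order_tendstoD)
  moreover have "eventually (\<lambda>p::real. 0 < p) (at_right 0)" by (rule eventually_at_right_less)
  ultimately show ?thesis
  proof eventually_elim
    case (elim p)
    have i: "(\<lambda>x. g x / (p + g x * a)) integrable_on {0..1}"
      using elim a by (intro integrand_integrable cont) auto
    have i': "(\<lambda>x. g x / (p + g x * a)) integrable_on {\<delta>..1}"
      using \<delta> by (intro integrable_on_subinterval[OF i]) auto
    have "(1 - \<delta>) * (m / (p + m * a)) = integral {\<delta>..1} (\<lambda>x. m / (p + m * a))"
      using \<delta> by simp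
    also have "\<dots> \<le> integral {\<delta>..1} (\<lambda>x. g x / (p + g x * a))"
    proof (intro integral_le i' integrable_const_ivl)
      fix x assume x: "x \<in> {\<delta>..1}"
      have "m \<le> g x" using x0(2)[OF x] by (simp add: m_def)
      moreover have "0 < p + m * a" "0 < p + g x * a"
        using m elim a \<open>m \<le> g x\<close> by (auto intro!: add_pos_pos mult_pos_pos)
      ultimately show "m / (p + m * a) \<le> g x / (p + g x * a)"
        using elim by (simp add: frac_le_eq divide_simps algebra_simps)
    qed
    also have "\<dots> \<le> I g p a"
      unfolding resolvent_integral_def
      using \<delta> elim a nonneg denominator_pos[of p a]
      by (intro integral_subset_le i i') (auto intro!: divide_nonneg_pos)
    finally show ?case using elim by simp
  qed
qed

section \<open>Regularity and limit of the solution\<close>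

end

locale profile_solution = profile +
  fixes v :: "real \<Rightarrow> real" and R :: real
  assumes R: "0 < R"
    and v_pos: "\<And>s. 0 < s \<Longrightarrow> s < R \<Longrightarrow> 0 < v s"
    and v_eq: "\<And>s. 0 < s \<Longrightarrow> s < R \<Longrightarrow> resolvent_integral g g (s\<^sup>2) (v s) = 1"
begin

lemma eventually_in_domain:
  "eventually (\<lambda>s. 0 < s \<and> s < R) (at_right 0)"
  using R by (simp add: eventually_at_right_field) blast

lemma solution_tendsto_1: "(v \<longlongrightarrow> 1) (at_right 0)"
proof (rule order_tendstoI)
  fix a :: real assume "a < 1"
  \<comment> \<open>The comparison needs a positive argument, so \<open>a\<close> is raised to at least \<open>1/2\<close>.\<close>
  define b where "b = max a (1 / 2)"
  have b: "0 < b" "b < 1" "a \<le> b" using \<open>a < 1\<close> by (auto simp: b_def)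
  have "filterlim (\<lambda>s::real. s\<^sup>2) (at_right 0) (at_right 0)"
    unfolding filterlim_at
    by (auto simp: eventually_at_right_field intro!: exI[of _ 1] tendsto_eq_intros)
  then have "eventually (\<lambda>s. 1 < I g (s\<^sup>2) b) (at_right 0)"
    using eventually_resolvent_integral_gt_1[OF b(1,2)] by (rule eventually_compose_filterlim[rotated])
  then show "eventually (\<lambda>s. a < v s) (at_right 0)"
    using eventually_in_domain
  proof eventually_elim
    case (elim s)
    then have "b < v s"
      using resolvent_integral_less_iff[of "s\<^sup>2" "v s" b] v_eq[of s] v_pos[of s] b by auto
    then show ?case using b by simp
  qed
next
  fix a :: real assume "1 < a"
  show "eventually (\<lambda>s. v s < a) (at_right 0)"
    using eventually_in_domain
  proof eventually_elim
    case (elim s)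
    have "\<not> 1 < v s"
      using resolvent_integral_less_iff[of "s\<^sup>2" "v s" 1] resolvent_integral_at_1_le[of "s\<^sup>2"]
        v_eq[of s] v_pos[of s] resolvent_integral_strict_antimono[of "s\<^sup>2" 1 "v s"] elim by auto
    then show ?case using \<open>1 < a\<close> by simp
  qed
qed

lemma eventually_near:
  assumes "0 < s" "s < R"
  shows "eventually (\<lambda>r. 0 < r \<and> r < R) (at s)"
  using eventually_at_in_open'[of "{0<..<R}" s] assms by auto

text \<open>If \<open>0 \<le> a < v s < b\<close> then \<open>I g (s\<^sup>2) a > 1 > I g (s\<^sup>2) b\<close>.  These strict inequalities persist for
  nearby arguments and trap the solution there.\<close>

lemma solution_continuous:
  assumes s: "0 < s" "s < R"
  shows "(v \<longlongrightarrow> v s) (at s)"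
proof -
  note vs = v_pos[OF s] v_eq[OF s]
  have lim: "((\<lambda>r. I g (r\<^sup>2) b) \<longlongrightarrow> I g (s\<^sup>2) b) (at s)" if "0 \<le> b" for b
    by (intro resolvent_integral_tendsto cont tendsto_intros that)
       (use s that eventually_near[OF s] in \<open>auto elim: eventually_mono\<close>)
  show ?thesis
  proof (rule order_tendstoI)
    fix a assume a: "a < v s"
    define b where "b = max a 0"
    have b: "0 \<le> b" "b < v s" "a \<le> b" using a vs by (auto simp: b_def)
    have "1 < I g (s\<^sup>2) b"
      using resolvent_integral_less_iff[of "s\<^sup>2" "v s" b] vs b s by auto
    then have "eventually (\<lambda>r. 1 < I g (r\<^sup>2) b) (at s)" using lim[OF b(1)] by (rule order_tendstoD[rotated])
    then show "eventually (\<lambda>r. a < v r) (at s)"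
      using eventually_near[OF s]
    proof eventually_elim
      case (elim r)
      then show ?case
        using resolvent_integral_less_iff[of "r\<^sup>2" "v r" b] v_eq[of r] v_pos[of r] b by auto
    qed
  next
    fix a assume a: "v s < a"
    have "I g (s\<^sup>2) a < 1"
      using resolvent_integral_less_iff[of "s\<^sup>2" a "v s"] vs a s by auto
    then have "eventually (\<lambda>r. I g (r\<^sup>2) a < 1) (at s)"
      using lim[of a] a vs by (intro order_tendstoD) auto
    then show "eventually (\<lambda>r. v r < a) (at s)"
      using eventually_near[OF s]
    proof eventually_elim
      case (elim r)
      then show ?case
        using resolvent_integral_less_iff[of "r\<^sup>2" a "v r"] v_eq[of r] v_pos[of r] a vs by auto
    qed
  qed
qed

text \<open>The integral equals \<open>1\<close> at both \<open>(s\<^sup>2, v s)\<close> and \<open>(r\<^sup>2, v r)\<close>, so the resolvent identity reads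
  \<open>0 = (r\<^sup>2 - s\<^sup>2) D + (v r - v s) E\<close> with mixed integrals \<open>D\<close> and \<open>E\<close>.  The difference quotient is thus
  \<open>- (r + s) D / E\<close>, and continuity of \<open>v\<close> allows passing to the limit.\<close>

lemma solution_has_derivative:
  assumes s: "0 < s" "s < R"
  defines "A \<equiv> \<lambda>k. I (\<lambda>x. g x ^ k / (s\<^sup>2 + g x * v s))"
  shows "(v has_real_derivative - (2 * s) * A 1 (s\<^sup>2) (v s) / A 2 (s\<^sup>2) (v s)) (at s)"
proof -
  note vs = v_pos[OF s] v_eq[OF s]
  have lim: "((\<lambda>r. A k (r\<^sup>2) (v r)) \<longlongrightarrow> A k (s\<^sup>2) (v s)) (at s)" for k
    unfolding A_def
  proof (intro resolvent_integral_tendsto weight_continuous tendsto_intros solution_continuous s)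
    show "eventually (\<lambda>r. 0 < r\<^sup>2) (at s)" "eventually (\<lambda>r. 0 \<le> v r) (at s)"
      using eventually_near[OF s] by (auto elim!: eventually_mono dest: v_pos less_imp_le)
  qed (use s vs in auto)
  have "A 2 (s\<^sup>2) (v s) \<noteq> 0"
    using weight_pos[of "s\<^sup>2" "v s" "s\<^sup>2" "v s" 2] s vs by (simp add: A_def)
  then have "((\<lambda>r. - (r + s) * A 1 (r\<^sup>2) (v r) / A 2 (r\<^sup>2) (v r)) \<longlongrightarrow>
      - (s + s) * A 1 (s\<^sup>2) (v s) / A 2 (s\<^sup>2) (v s)) (at s)"
    by (intro tendsto_intros lim)
  moreover have "eventually (\<lambda>r. - (r + s) * A 1 (r\<^sup>2) (v r) / A 2 (r\<^sup>2) (v r)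
      = (v r - v s) / (r - s)) (at s)"
    using eventually_near[OF s] eventually_neq_at_within[of s s UNIV]
  proof eventually_elim
    case (elim r)
    then have r: "0 < r" "r < R" "r \<noteq> s" by auto
    have E: "0 < A 2 (r\<^sup>2) (v r)"
      using weight_pos[of "s\<^sup>2" "v s" "r\<^sup>2" "v r" 2] s vs v_pos[of r] r by (simp add: A_def)
    have "0 = (r\<^sup>2 - s\<^sup>2) * A 1 (r\<^sup>2) (v r) + (v r - v s) * A 2 (r\<^sup>2) (v r)"
      using resolvent_identity[of "s\<^sup>2" "v s" "r\<^sup>2" "v r"] s vs v_pos[of r] v_eq[of r] r
      by (simp add: A_def)
    then have "(v r - v s) * A 2 (r\<^sup>2) (v r) = - (r + s) * A 1 (r\<^sup>2) (v r) * (r - s)"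
      by (simp add: power2_eq_square algebra_simps)
    then show ?case using E r by (simp add: frac_eq_eq)
  qed
  ultimately show ?thesis
    unfolding has_field_derivative_iff by (auto elim: Lim_transform_eventually)
qed

lemma square_mass_tendsto_1:
  "((\<lambda>s. I (\<lambda>x. g x ^ 2 / (s\<^sup>2 + g x * v s)) (s\<^sup>2) (v s)) \<longlongrightarrow> 1) (at_right 0)"
proof (rule tendsto_sandwich)
  let ?E = "\<lambda>s. I (\<lambda>x. g x ^ 2 / (s\<^sup>2 + g x * v s)) (s\<^sup>2) (v s)"
  have b: "(2 * v s - 1) / (v s)\<^sup>2 \<le> ?E s \<and> ?E s \<le> v s / (v s)\<^sup>2" if "0 < s \<and> s < R" for s
    using square_mass_bounds[of "s\<^sup>2" "v s"] that v_pos[of s] v_eq[of s]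
    by (simp add: pos_divide_le_eq pos_le_divide_eq mult.commute)
  show "eventually (\<lambda>s. (2 * v s - 1) / (v s)\<^sup>2 \<le> ?E s) (at_right 0)"
    "eventually (\<lambda>s. ?E s \<le> v s / (v s)\<^sup>2) (at_right 0)"
    using eventually_in_domain b by (auto elim: eventually_mono)
  show "((\<lambda>s. (2 * v s - 1) / (v s)\<^sup>2) \<longlongrightarrow> 1) (at_right 0)"
    "((\<lambda>s. v s / (v s)\<^sup>2) \<longlongrightarrow> 1) (at_right 0)"
    by (auto intro!: tendsto_eq_intros solution_tendsto_1)
qed

end

section \<open>The density near the origin\<close>

theorem proposition4p3:
  fixes d :: "real \<Rightarrow> real" and \<sigma> :: "nat \<Rightarrow> nat \<Rightarrow> nat \<Rightarrow> real"
  assumes "continuous_on {0..1} d"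
    and "d 0 = 0"
    and "\<And>x. 0 < x \<Longrightarrow> x \<le> 1 \<Longrightarrow> d x > 0"
    and "\<And>n i j. i \<in> {1..n} \<Longrightarrow> j \<in> {1..n} \<Longrightarrow>
           (\<sigma> n i j)\<^sup>2 = d (real i / real n) * d (real j / real n)"
  shows "((\<lambda>z::complex. f_inf d z /
            (1 / pi * integral {0..1} (\<lambda>x. (d x)\<^sup>2 / ((norm z)\<^sup>2 + (d x)\<^sup>2 * u_inf d (norm z))\<^sup>2)))
          \<longlongrightarrow> 1) (at 0)"
proof -
  define g where "g = (\<lambda>x. (d x)\<^sup>2)"
  define R where "R = sqrt (rho_inf d)"
  define v where "v = u_inf d"
  interpret profile g
    using assms(1,3) by unfold_locales (auto simp: g_def intro!: continuous_intros less_imp_neq[symmetric])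
  \<comment> \<open>With \<open>p = 1\<close> and \<open>q = 0\<close> the resolvent integral of \<open>g\<close> is \<open>rho_inf d\<close>.\<close>
  have "0 < I g 1 0"
    by (intro resolvent_integral_pos cont nonneg pos) auto
  then have R: "0 < R" by (simp add: R_def rho_inf_def resolvent_integral_def g_def)
  have sol: "0 < v s \<and> I g (s\<^sup>2) (v s) = 1" if s: "0 < s" "s < R" for s
  proof -
    have "s\<^sup>2 < rho_inf d" using power_strict_mono[of s R 2] s R by (simp add: R_def)
    then have "\<exists>!u. 0 < u \<and> I g (s\<^sup>2) u = 1"
      using s by (intro solution_exists_unique) (auto simp: rho_inf_def g_def)
    from theI'[OF this] show ?thesis
      using s by (simp add: v_def u_inf_def u_inf_pos_def R_def resolvent_integral_def g_def)
  qed
  then interpret profile_solution g v R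
    using R by unfold_locales auto
  let ?E = "\<lambda>s. I (\<lambda>x. g x ^ 2 / (s\<^sup>2 + g x * v s)) (s\<^sup>2) (v s)"
  let ?D = "\<lambda>s. I (\<lambda>x. g x ^ 1 / (s\<^sup>2 + g x * v s)) (s\<^sup>2) (v s)"
  have "filterlim (norm :: complex \<Rightarrow> real) (at_right 0) (at 0)"
    unfolding filterlim_at
    by (auto simp: eventually_at_filter intro!: tendsto_norm_zero tendsto_ident_at)
  note to_radius = filterlim_compose[OF _ this]
    and ev_radius = eventually_compose_filterlim[OF eventually_in_domain this]
  have "((\<lambda>z::complex. 1 / ?E (norm z)) \<longlongrightarrow> 1 / 1) (at 0)"
    by (intro tendsto_intros to_radius[OF square_mass_tendsto_1]) auto
  moreover have "eventually (\<lambda>z::complex. 1 / ?E (norm z) = f_inf d z /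
            (1 / pi * integral {0..1} (\<lambda>x. (d x)\<^sup>2 / ((norm z)\<^sup>2 + (d x)\<^sup>2 * u_inf d (norm z))\<^sup>2)))
            (at 0)"
    using ev_radius
  proof eventually_elim
    case (elim z)
    define s where "s = norm z"
    have s: "0 < s" "s < R" using elim by (auto simp: s_def)
    have "deriv v s = - (2 * s) * ?D s / ?E s"
      by (intro DERIV_imp_deriv solution_has_derivative s)
    then have f: "f_inf d z = ?D s / (pi * ?E s)"
      using s by (simp add: f_inf_def flip: s_def v_def)
    have D: "integral {0..1} (\<lambda>x. (d x)\<^sup>2 / ((norm z)\<^sup>2 + (d x)\<^sup>2 * u_inf d (norm z))\<^sup>2) = ?D s"
      by (simp add: resolvent_integral_def g_def power2_eq_square flip: s_def v_def)
    have "0 < ?D s"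
      using s v_pos[OF s] by (intro weight_pos) auto
    then show ?case unfolding D f using s_def by simp
  qed
  ultimately show ?thesis by (auto elim: Lim_transform_eventually)
qed

end
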